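(* Let $X$ be a real normed space, let $\mathcal F$ be a directionally fine family of closed cones in $X$ and let $L\subset X$ be a locally compact cone. For every $\varepsilon\in(0,1)$ there exist $C_1,\ldots,C_m\in\mathcal F$ such that $D_L^\varepsilon:=\bigcup_{i=1}^mC_i$ is a closed cone, \[ L\setminus\{0_X\}\subset\bigcup_{i=1}^m\operatorname{int}C_i\subset\operatorname{int}D_L^\varepsilon,\qquad L\subset D_L^\varepsilon\subset L_\varepsilon, \] and \[ D_L^\varepsilon\cap S_X\subset\{x\in S_X:d(x,B_L)\le2\varepsilon\}. \]
   Context: $S_X$, $B_X$ are the unit sphere and closed unit ball, $B(x,r)=x+rB_X$, $\operatorname{cone}(A)=\{ta:t\ge0,\ a\in A\}$, $d(x,A)=\inf_{a\in A}\|x-a\|$. A nonempty set $C\subset X$ is a cone if $tC\subset C$ for every $t\ge 0$; all cones are assumed proper, i.e. $\{0_X\}\subsetneq C\subsetneq X$ (not necessarily convex). A family $\mathcal F$ of closed cones in $X$ is directionally fine if for every $u\in S_X$ and $\varepsilon\in(0,1)$ there exists $C\in\mathcal F$ with $u\in\operatorname{int}C\subset C\subset\operatorname{cone}B(u,\varepsilon)$. A cone $L$ is locally compact if it is locally compact in the relative norm topology, i.e. for every $x\in L$ there is $r>0$ with $L\cap B(x,r)$ compact. $B_L:=L\cap S_X$ is the norm-base of $L$, and $L_\varepsilon:=\operatorname{cone}(B_L+\varepsilon B_X)$. *)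

theory Defs
  imports "HOL-Analysis.Analysis"
begin

definition proper_cone :: "'a::real_normed_vector set \<Rightarrow> bool" where
  "proper_cone C \<longleftrightarrow> cone C \<and> {0} \<subset> C \<and> C \<subset> UNIV"

definition cone_of :: "'a::real_normed_vector set \<Rightarrow> 'a set" where
  "cone_of A = {t *\<^sub>R a | t a. 0 \<le> t \<and> a \<in> A}"

lemma cone_of_eq_cone_hull: "cone_of A = cone hull A"
  by (simp add: cone_of_def cone_hull_expl)

definition directionally_fine :: "'a::real_normed_vector set set \<Rightarrow> bool" where
  "directionally_fine F \<longleftrightarrow>
     (\<forall>C\<in>F. proper_cone C \<and> closed C) \<and>
     (\<forall>u\<in>sphere 0 1. \<forall>\<epsilon>. 0 < \<epsilon> \<and> \<epsilon> < 1 \<longrightarrow>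
        (\<exists>C\<in>F. u \<in> interior C \<and> interior C \<subseteq> C \<and> C \<subseteq> cone_of (cball u \<epsilon>)))"

definition norm_base :: "'a::real_normed_vector set \<Rightarrow> 'a set" where
  "norm_base L = L \<inter> sphere 0 1"

definition cone_enlargement :: "'a::real_normed_vector set \<Rightarrow> real \<Rightarrow> 'a set" where
  "cone_enlargement L \<epsilon> = cone_of {b + \<epsilon> *\<^sub>R v | b v. b \<in> norm_base L \<and> v \<in> cball 0 1}"

text \<open>In a normed space the library notion \<^term>\<open>locally compact L\<close> of local compactness in the
  relative topology amounts to every point of \<open>L\<close> having a compact relative closed ball.\<close>

lemma locally_compact_iff_cball:
  fixes L :: "'a::real_normed_vector set"
  shows "locally compact L \<longleftrightarrow> (\<forall>x\<in>L. \<exists>r>0. compact (L \<inter> cball x r))"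
proof
  assume lc: "locally compact L"
  show "\<forall>x\<in>L. \<exists>r>0. compact (L \<inter> cball x r)"
  proof
    fix x assume "x \<in> L"
    moreover have "openin (top_of_set L) L" by simp
    ultimately obtain u v where uv: "openin (top_of_set L) u" "compact v" "x \<in> u" "u \<subseteq> v" "v \<subseteq> L"
      using lc unfolding locally_def by metis
    obtain r where r: "r > 0" "L \<inter> cball x r \<subseteq> u"
      using uv(1,3) unfolding openin_contains_cball by (metis Int_commute)
    have "L \<inter> cball x r = v \<inter> cball x r" using r uv by blast
    then have "compact (L \<inter> cball x r)" using uv(2) by (simp add: compact_Int_closed)
    then show "\<exists>r>0. compact (L \<inter> cball x r)" using r(1) by blast
  qed
next
  assume cb: "\<forall>x\<in>L. \<exists>r>0. compact (L \<inter> cball x r)"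
  show "locally compact L"
    unfolding locally_def
  proof (intro allI impI)
    fix w x assume w: "openin (top_of_set L) w \<and> x \<in> w"
    then obtain e where e: "e > 0" "cball x e \<inter> L \<subseteq> w"
      unfolding openin_contains_cball by blast
    have "x \<in> L" using w openin_imp_subset by blast
    then obtain r where r: "r > 0" "compact (L \<inter> cball x r)" using cb by blast
    define s where "s = min e r"
    have s: "s > 0" "s \<le> e" "s \<le> r" using e r by (auto simp: s_def)
    have "L \<inter> cball x s = (L \<inter> cball x r) \<inter> cball x s" using s(3) by auto
    then have "compact (L \<inter> cball x s)" using r(2) by (metis compact_Int_closed closed_cball)
    moreover have "openin (top_of_set L) (L \<inter> ball x s)" by (simp add: openin_open_Int)
    moreover have "x \<in> L \<inter> ball x s" using s(1) \<open>x \<in> L\<close> by simp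
    moreover have "L \<inter> ball x s \<subseteq> L \<inter> cball x s" using ball_subset_cball by blast
    moreover have "L \<inter> cball x s \<subseteq> w" using e(2) s(2) by (auto simp: subset_iff)
    ultimately show "\<exists>u v. openin (top_of_set L) u \<and> compact v \<and> x \<in> u \<and> u \<subseteq> v \<and> v \<subseteq> w"
      by blast
  qed
qed

end

theory Submission
  imports Defs
begin

text \<open>
  Local compactness at the vertex, together with homogeneity, makes the norm-base of \<open>L\<close> compact;
  hence \<open>L\<close> is closed and the norm-base is covered by the interiors of finitely many members
  \<open>C\<^sub>i \<subseteq> cone B(b\<^sub>i, \<delta>)\<close> of the family. A unit vector in \<open>cone B(b, \<delta>)\<close> is within \<open>2\<delta>\<close> of \<open>b\<close>.
  For \<open>\<delta> = \<epsilon>\<close> the union of the \<open>C\<^sub>i\<close> may be the whole space, so \<open>\<delta> \<le> \<epsilon>\<close> is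
  chosen so small that some unit vector outside \<open>L\<close> is further than \<open>2\<delta>\<close> from the norm-base.
\<close>

lemma scaleR_mem_cone:
  assumes "cone C" "0 \<le> t" "x \<in> C"
  shows "t *\<^sub>R x \<in> C"
  using assms by (simp add: cone_def)

text \<open>Scaling by \<open>t > 0\<close> sends the interior to an open set, which homogeneity
  keeps inside \<open>C\<close>.\<close>

lemma scaleR_mem_interior_cone:
  fixes C :: "'a::real_normed_vector set"
  assumes "cone C" "x \<in> interior C" "0 < t"
  shows "t *\<^sub>R x \<in> interior C"
proof -
  have "open ((*\<^sub>R) t ` interior C)"
    using assms(3) by (intro open_scaling) auto
  moreover have "(*\<^sub>R) t ` interior C \<subseteq> C"
    using assms(1,3) interior_subset by (fastforce intro: scaleR_mem_cone)
  ultimately show ?thesis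
    using assms(2) interior_maximal by blast
qed

text \<open>Scaling the compact set \<open>L \<inter> cball 0 r\<close> by \<open>1 / r\<close>
  yields the part of \<open>L\<close> in the closed unit ball, and the norm-base is a closed subset
  of that.\<close>

lemma compact_norm_base:
  fixes L :: "'a::real_normed_vector set"
  assumes "cone L" "0 \<in> L" "locally compact L"
  shows "compact (norm_base L)"
proof -
  obtain r where r: "r > 0" "compact (L \<inter> cball 0 r)"
    using assms(2,3) locally_compact_iff_cball by blast
  have "compact ((*\<^sub>R) (1 / r) ` (L \<inter> cball 0 r))"
    using r(2) by (rule compact_scaling)
  moreover have "closed (sphere (0::'a) 1)"
    by (auto simp: sphere_def intro!: closed_Collect_eq continuous_intros)
  ultimately have "compact ((*\<^sub>R) (1 / r) ` (L \<inter> cball 0 r) \<inter> sphere 0 1)"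
    by (rule compact_Int_closed)
  moreover have "norm_base L = (*\<^sub>R) (1 / r) ` (L \<inter> cball 0 r) \<inter> sphere 0 1"
  proof (intro equalityI subsetI)
    fix x assume x: "x \<in> norm_base L"
    then have "x = (1 / r) *\<^sub>R (r *\<^sub>R x)" "r *\<^sub>R x \<in> L \<inter> cball 0 r"
      using r(1) assms(1) by (auto simp: norm_base_def intro: scaleR_mem_cone)
    with x show "x \<in> (*\<^sub>R) (1 / r) ` (L \<inter> cball 0 r) \<inter> sphere 0 1"
      unfolding norm_base_def by blast
  next
    fix x assume "x \<in> (*\<^sub>R) (1 / r) ` (L \<inter> cball 0 r) \<inter> sphere 0 1"
    then show "x \<in> norm_base L"
      using r(1) assms(1) scaleR_mem_cone[OF assms(1), of "1 / r"] by (auto simp: norm_base_def)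
  qed
  ultimately show ?thesis by simp
qed

lemma norm_scaled_mem_norm_base:
  assumes "cone L" "x \<in> L" "x \<noteq> 0"
  shows "(1 / norm x) *\<^sub>R x \<in> norm_base L"
  using assms by (auto simp: norm_base_def intro: scaleR_mem_cone)

text \<open>Write \<open>x = t *\<^sub>R a\<close> with \<open>a\<close> in the ball. As
  \<open>x\<close> and \<open>a\<close> lie on one ray, their distance is the difference of their
  norms, which is at most \<delta> because \<open>b\<close> is also a unit vector. The step from
  \<open>a\<close> to \<open>b\<close> costs a second \<delta>.\<close>

lemma dist_le_if_mem_cone_of_cball:
  fixes b x :: "'a::real_normed_vector"
  assumes "x \<in> cone_of (cball b \<delta>)" "norm b = 1" "norm x = 1"
  shows "dist x b \<le> 2 * \<delta>"
proof -
  obtain t a where ta: "x = t *\<^sub>R a" "0 \<le> t" "norm (b - a) \<le> \<delta>"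
    using assms(1) by (auto simp: cone_of_def dist_norm)
  have ta1: "t * norm a = 1"
    using ta assms(3) by simp
  have "norm (x - a) = \<bar>t - 1\<bar> * norm a"
    using ta(1) by (metis norm_scaleR scaleR_left_diff_distrib scaleR_one)
  also have "\<dots> = \<bar>(t - 1) * norm a\<bar>"
    by (simp add: abs_mult)
  also have "\<dots> = \<bar>norm b - norm a\<bar>"
    using ta1 assms(2) by (simp add: algebra_simps)
  also have "\<dots> \<le> \<delta>"
    using norm_triangle_ineq3[of b a] ta(3) by linarith
  finally have "dist x a \<le> \<delta>" by (simp add: dist_norm)
  moreover have "dist a b \<le> \<delta>"
    using ta(3) by (simp add: dist_norm norm_minus_commute)
  ultimately show ?thesis
    using dist_triangle[of x b a] by linarith
qed

lemma cone_of_cball_subset_cone_enlargement: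
  fixes b :: "'a::real_normed_vector"
  assumes "b \<in> norm_base L" "0 < \<epsilon>" "\<delta> \<le> \<epsilon>"
  shows "cone_of (cball b \<delta>) \<subseteq> cone_enlargement L \<epsilon>"
proof -
  have "\<exists>b' v. a = b' + \<epsilon> *\<^sub>R v \<and> b' \<in> norm_base L \<and> v \<in> cball 0 1" if "a \<in> cball b \<delta>" for a
  proof (intro exI conjI)
    show "a = b + \<epsilon> *\<^sub>R ((1 / \<epsilon>) *\<^sub>R (a - b))" using assms(2) by simp
    show "(1 / \<epsilon>) *\<^sub>R (a - b) \<in> cball 0 1"
      using that assms(2,3)
      by (simp add: dist_norm norm_minus_commute divide_le_eq del: scaleR_diff_right)
  qed (fact assms(1))
  then show ?thesis
    unfolding cone_enlargement_def cone_of_def by blast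
qed

text \<open>Normalising a point outside \<open>L\<close> keeps it outside by homogeneity, and
  closedness makes its distance positive. Nonemptiness matters since \<open>infdist\<close> to the
  empty set is 0 by convention.\<close>

lemma exists_unit_vector_away_from_norm_base:
  fixes L :: "'a::real_normed_vector set"
  assumes "proper_cone L" "closed (norm_base L)" "norm_base L \<noteq> {}"
  shows "\<exists>u. norm u = 1 \<and> 0 < infdist u (norm_base L)"
proof -
  have L: "cone L" "0 \<in> L" and "L \<noteq> UNIV"
    using assms(1) by (auto simp: proper_cone_def)
  then obtain x where x: "x \<notin> L" by blast
  then have "x \<noteq> 0" using L(2) by blast
  define u where "u = (1 / norm x) *\<^sub>R x"
  have "x = norm x *\<^sub>R u" "norm u = 1"
    using \<open>x \<noteq> 0\<close> by (auto simp: u_def)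
  then have "u \<notin> norm_base L"
    using x L(1) scaleR_mem_cone[of L "norm x" u] by (auto simp: norm_base_def)
  then show ?thesis
    using assms(2,3) \<open>norm u = 1\<close> infdist_pos_not_in_closed by blast
qed

theorem theorem3p21:
  fixes F :: "'a::real_normed_vector set set" and L :: "'a set" and \<epsilon> :: real
  assumes "directionally_fine F"
    and "proper_cone L" and "locally compact L"
    and "0 < \<epsilon>" and "\<epsilon> < 1"
  shows "\<exists>(m::nat) (C :: nat \<Rightarrow> 'a set) D.
           (\<forall>i\<in>{1..m}. C i \<in> F) \<and> D = (\<Union>i\<in>{1..m}. C i) \<and>
           proper_cone D \<and> closed D \<and>
           L - {0} \<subseteq> (\<Union>i\<in>{1..m}. interior (C i)) \<and>
           (\<Union>i\<in>{1..m}. interior (C i)) \<subseteq> interior D \<and>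
           L \<subseteq> D \<and> D \<subseteq> cone_enlargement L \<epsilon> \<and>
           D \<inter> sphere 0 1 \<subseteq> {x \<in> sphere 0 1. infdist x (norm_base L) \<le> 2 * \<epsilon>}"
proof -
  let ?B = "norm_base L"
  have L: "cone L" "0 \<in> L" "L \<noteq> {0}"
    using assms(2) by (auto simp: proper_cone_def)
  have B_compact: "compact ?B"
    using L assms(3) compact_norm_base by blast
  obtain z where "z \<in> L" "z \<noteq> 0" using L by blast
  then have B_ne: "?B \<noteq> {}"
    using norm_scaled_mem_norm_base[OF L(1)] by blast
  obtain u where u: "norm u = 1" "0 < infdist u ?B"
    using exists_unit_vector_away_from_norm_base[OF assms(2) compact_imp_closed[OF B_compact] B_ne]
    by blast
  \<comment> \<open>Dividing by 3 makes \<open>2 * \<delta>\<close> strictly smaller than the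
    distance of \<open>u\<close>, so that \<open>u\<close> will stay outside the union. The bound by
    \<epsilon> gives \<delta> < 1, as directional fineness requires.\<close>
  define \<delta> where "\<delta> = min \<epsilon> (infdist u ?B / 3)"
  have \<delta>: "0 < \<delta>" "\<delta> < 1" "\<delta> \<le> \<epsilon>" "2 * \<delta> < infdist u ?B"
    using assms(4,5) u(2) by (auto simp: \<delta>_def)
  have F: "\<And>C. C \<in> F \<Longrightarrow> cone C \<and> 0 \<in> C \<and> closed C"
    using assms(1) unfolding directionally_fine_def proper_cone_def by blast
  \<comment> \<open>Each member keeps a centre \<open>b\<close> in the norm-base, so any finite
    subcover automatically stays close to \<open>L\<close>.\<close>
  define G where "G = {C \<in> F. \<exists>b\<in>?B. C \<subseteq> cone_of (cball b \<delta>)}"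
  have cover: "?B \<subseteq> \<Union> (interior ` G)"
  proof
    fix b assume b: "b \<in> ?B"
    then have "b \<in> sphere 0 1" by (simp add: norm_base_def)
    then obtain C where "C \<in> F" "b \<in> interior C" "C \<subseteq> cone_of (cball b \<delta>)"
      using assms(1) \<delta>(1,2) unfolding directionally_fine_def by blast
    then show "b \<in> \<Union> (interior ` G)" using b by (auto simp: G_def)
  qed
  obtain H where H: "H \<subseteq> G" "finite H" "?B \<subseteq> \<Union> (interior ` H)"
    using compactE_image[OF B_compact, of G interior] cover by auto
  obtain C where "bij_betw C {1..card H} H"
    using ex_bij_betw_nat_finite_1[OF H(2)] by blast
  then have CH: "C ` {1..card H} = H"
    by (simp add: bij_betw_def)
  have HF: "\<And>K. K \<in> H \<Longrightarrow> K \<in> F"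
    using H(1) by (auto simp: G_def)
  have H_sub: "\<exists>b\<in>?B. K \<subseteq> cone_of (cball b \<delta>)" if "K \<in> H" for K
    using that H(1) by (auto simp: G_def)
  have L_int: "L - {0} \<subseteq> \<Union> (interior ` H)"
  proof
    fix x assume x: "x \<in> L - {0}"
    then have "(1 / norm x) *\<^sub>R x \<in> ?B"
      using norm_scaled_mem_norm_base[OF L(1)] by blast
    then obtain K where K: "K \<in> H" "(1 / norm x) *\<^sub>R x \<in> interior K"
      using H(3) by blast
    \<comment> \<open>Interiors of cones are stable under positive scaling, so the cover of the
      norm-base extends along rays.\<close>
    then have "norm x *\<^sub>R ((1 / norm x) *\<^sub>R x) \<in> interior K"
      using x F HF by (intro scaleR_mem_interior_cone[OF _ K(2)]) auto
    then show "x \<in> \<Union> (interior ` H)" using x K(1) by auto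
  qed
  \<comment> \<open>The vertex is not supplied by the interiors; it lies in the union because at
    least one cone was selected.\<close>
  have "H \<noteq> {}" using H(3) B_ne by blast
  then have D0: "0 \<in> \<Union> H" using F HF by blast
  have L_D: "L \<subseteq> \<Union> H"
    using L_int D0 interior_subset by blast
  have D_near: "infdist x ?B \<le> 2 * \<delta>" if x: "x \<in> \<Union> H" "norm x = 1" for x
  proof -
    obtain b where b: "b \<in> ?B" "x \<in> cone_of (cball b \<delta>)"
      using x(1) H_sub by blast
    then have "dist x b \<le> 2 * \<delta>"
      using x(2) by (intro dist_le_if_mem_cone_of_cball) (auto simp: norm_base_def)
    then show ?thesis using infdist_le2[OF b(1)] by blast
  qed
  \<comment> \<open>This is what makes the union differ from the whole space.\<close>
  have "u \<notin> \<Union> H" using D_near[of u] u(1) \<delta>(4) by linarith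
  moreover have "cone (\<Union> H)"
    using F HF unfolding cone_def by blast
  ultimately have "proper_cone (\<Union> H)"
    using L L_D unfolding proper_cone_def by blast
  moreover have "closed (\<Union> H)"
    using H(2) F HF by (intro closed_Union) auto
  moreover have "\<Union> H \<subseteq> cone_enlargement L \<epsilon>"
    using H_sub cone_of_cball_subset_cone_enlargement[OF _ assms(4) \<delta>(3)] by blast
  moreover have "\<Union> H \<inter> sphere 0 1 \<subseteq> {x \<in> sphere 0 1. infdist x ?B \<le> 2 * \<epsilon>}"
    using D_near \<delta>(3) by fastforce
  moreover have "\<Union> (interior ` H) \<subseteq> interior (\<Union> H)"
    by (intro Union_least) (auto intro: interior_mono[THEN subsetD, rotated])
  moreover have "(\<Union>i\<in>{1..card H}. interior (C i)) = \<Union> (interior ` H)"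
    using CH by (metis image_image)
  moreover have "\<forall>i\<in>{1..card H}. C i \<in> F"
    using HF CH by blast
  ultimately show ?thesis
    using L_int L_D CH
    by (intro exI[of _ "card H"] exI[of _ C] exI[of _ "\<Union> H"]) auto
qed

end
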